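(* A permutation class $\mathrm{Av}(B)$ contains only finitely many proper pin-permutations if and only if the set $\mathcal{M}\setminus\bigcup_{\pi\in B}\mathcal{L}_\pi$ is finite.
   Context: $\mathrm{Av}(B)$ is the set of permutations containing no element of $B$ as a pattern ($B$ an antichain for the pattern order). A pin representation of a permutation is a sequence of points $(p_1,\dots,p_n)$, no two on a common horizontal or vertical line, order-isomorphic to the permutation's diagram $\{(i,\pi_i)\}$, where each $p_i$ ($i\ge2$) lies outside the bounding box (smallest axis-parallel rectangle) of $\{p_1,\dots,p_{i-1}\}$ and either separates $p_{i-1}$ from $\{p_1,\dots,p_{i-2}\}$ (the horizontal or vertical line through $p_i$ has them on opposite sides) or separates no two nonempty subsets of $\{p_1,\dots,p_{i-1}\}$. A permutation is a proper pin-permutation if it has a pin representation in which every $p_i$, $i\ge3$, separates $p_{i-1}$ from $\{p_1,\dots,p_{i-2}\}$. Choosing an origin $p_0$ such that $(p_0,\dots,p_n)$ satisfies the same conditions, encode $p_i$ ($i\ge1$) by $U/D/L/R$ if $p_i$ separates $p_{i-1}$ from $\{p_0,\dots,p_{i-2}\}$ from the top/bottom/left/right, and by $1/2/3/4$ if $p_i$ separates no two nonempty subsets of $\{p_0,\dots,p_{i-1}\}$ and lies up-right/up-left/bottom-left/bottom-right of their bounding box. $P(\pi)$ is the set of all such pin words of $\pi$ (empty if $\pi$ has no pin representation). A strict pin word is a numeral followed only by directions. Cutting a pin word $u$ before each numeral gives its strong numeral-led factor decomposition $u=u^{(1)}\cdots u^{(j)}$. $A=\{U,D,L,R\}$; $\mathcal{M}$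 is the set of words of length at least $2$ over $A$ in which letters of $\{L,R\}$ and letters of $\{U,D\}$ alternate. $\phi$ maps a strict pin word $u=u'u''$, $|u'|=2$, to $\varphi(u')u''$ with $\varphi$: $1R\mapsto RUR$, $1L\mapsto RUL$, $1U\mapsto URU$, $1D\mapsto URD$, $2R\mapsto LUR$, $2L\mapsto LUL$, $2U\mapsto ULU$, $2D\mapsto ULD$, $3R\mapsto LDR$, $3L\mapsto LDL$, $3U\mapsto DLU$, $3D\mapsto DLD$, $4R\mapsto RDR$, $4L\mapsto RDL$, $4U\mapsto DRU$, $4D\mapsto DRD$, and single numerals to sets $\phi(1)=\{UR,RU\}$, $\phi(2)=\{UL,LU\}$, $\phi(3)=\{DL,LD\}$, $\phi(4)=\{RD,DR\}$. $\mathcal{L}(u)=A^\star\phi(u^{(1)})A^\star\cdots A^\star\phi(u^{(j)})A^\star$ and $\mathcal{L}_\pi=\bigcup_{u\in P(\pi)}\mathcal{L}(u)$. *)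

theory Defs
  imports Complex_Main "HOL-Combinatorics.Multiset_Permutations"
begin

text \<open>Permutations are written in one-line notation, as lists of the numbers $1,\dots,n$.\<close>

definition perms :: "nat list set" where
  "perms = (\<Union>n. permutations_of_set {1..n})"

definition pattern_of :: "nat list \<Rightarrow> nat list \<Rightarrow> bool" where
  "pattern_of \<sigma> \<pi> \<longleftrightarrow>
     (\<exists>f. strict_mono_on {..<length \<sigma>} f \<and> f ` {..<length \<sigma>} \<subseteq> {..<length \<pi>} \<and>
          (\<forall>i<length \<sigma>. \<forall>j<length \<sigma>. \<sigma> ! i < \<sigma> ! j \<longleftrightarrow> \<pi> ! f i < \<pi> ! f j))"

definition pattern_antichain :: "nat list set \<Rightarrow> bool" where
  "pattern_antichain B \<longleftrightarrow> (\<forall>\<sigma>\<in>B. \<forall>\<tau>\<in>B. pattern_of \<sigma> \<tau> \<longrightarrow> \<sigma> = \<tau>)"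

definition Av :: "nat list set \<Rightarrow> nat list set" where
  "Av B = {\<pi> \<in> perms. \<forall>\<sigma>\<in>B. \<not> pattern_of \<sigma> \<pi>}"

type_synonym point = "real \<times> real"

definition diagram :: "nat list \<Rightarrow> point set" where
  "diagram \<pi> = {(real (Suc i), real (\<pi> ! i)) | i. i < length \<pi>}"

definition order_isomorphic :: "point set \<Rightarrow> point set \<Rightarrow> bool" where
  "order_isomorphic X Y \<longleftrightarrow>
     (\<exists>f. bij_betw f X Y \<and>
          (\<forall>p\<in>X. \<forall>q\<in>X. (fst p < fst q \<longleftrightarrow> fst (f p) < fst (f q)) \<and>
                         (snd p < snd q \<longleftrightarrow> snd (f p) < snd (f q))))"

text \<open>Only used for finite nonempty sets of points.\<close>

definition bounding_box :: "point set \<Rightarrow> point set" where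
  "bounding_box S = {Min (fst ` S)..Max (fst ` S)} \<times> {Min (snd ` S)..Max (snd ` S)}"

text \<open>Both sets have to be nonempty; in particular the second point of a sequence never
  separates the first one from the (empty) set of its predecessors.\<close>

definition separates :: "point \<Rightarrow> point set \<Rightarrow> point set \<Rightarrow> bool" where
  "separates p E F \<longleftrightarrow> E \<noteq> {} \<and> F \<noteq> {} \<and>
     ((\<forall>e\<in>E. \<forall>f\<in>F. fst e < fst p \<and> fst p < fst f) \<or>
      (\<forall>e\<in>E. \<forall>f\<in>F. fst f < fst p \<and> fst p < fst e) \<or>
      (\<forall>e\<in>E. \<forall>f\<in>F. snd e < snd p \<and> snd p < snd f) \<or>
      (\<forall>e\<in>E. \<forall>f\<in>F. snd f < snd p \<and> snd p < snd e))"

text \<open>In the following, lists of points are indexed from $0$, so that the predecessors of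
  \<open>ps ! i\<close> are the elements of \<open>take i ps\<close>.\<close>

definition separating_pin :: "point list \<Rightarrow> nat \<Rightarrow> bool" where
  "separating_pin ps i \<longleftrightarrow> separates (ps ! i) {ps ! (i - 1)} (set (take (i - 1) ps))"

definition independent_pin :: "point list \<Rightarrow> nat \<Rightarrow> bool" where
  "independent_pin ps i \<longleftrightarrow>
     \<not> (\<exists>E F. E \<subseteq> set (take i ps) \<and> F \<subseteq> set (take i ps) \<and> E \<noteq> {} \<and> F \<noteq> {} \<and>
              separates (ps ! i) E F)"

definition pin_sequence :: "point list \<Rightarrow> bool" where
  "pin_sequence ps \<longleftrightarrow>
     distinct (map fst ps) \<and> distinct (map snd ps) \<and>
     (\<forall>i. 1 \<le> i \<and> i < length ps \<longrightarrow>
          ps ! i \<notin> bounding_box (set (take i ps)) \<and>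
          (separating_pin ps i \<or> independent_pin ps i))"

definition pin_representation :: "nat list \<Rightarrow> point list \<Rightarrow> bool" where
  "pin_representation \<pi> ps \<longleftrightarrow>
     pin_sequence ps \<and> order_isomorphic (set ps) (diagram \<pi>)"

definition proper_pin_permutation :: "nat list \<Rightarrow> bool" where
  "proper_pin_permutation \<pi> \<longleftrightarrow> \<pi> \<in> perms \<and>
     (\<exists>ps. pin_representation \<pi> ps \<and> (\<forall>i. 2 \<le> i \<and> i < length ps \<longrightarrow> separating_pin ps i))"

datatype letter = N1 | N2 | N3 | N4 | U | D | L | R

definition numerals :: "letter set" where
  "numerals = {N1, N2, N3, N4}"

definition directions :: "letter set" where
  "directions = {U, D, L, R}"

definition above :: "point \<Rightarrow> point set \<Rightarrow> bool" where
  "above p S \<longleftrightarrow> (\<forall>q\<in>S. snd q < snd p)"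

definition below :: "point \<Rightarrow> point set \<Rightarrow> bool" where
  "below p S \<longleftrightarrow> (\<forall>q\<in>S. snd p < snd q)"

definition left_of :: "point \<Rightarrow> point set \<Rightarrow> bool" where
  "left_of p S \<longleftrightarrow> (\<forall>q\<in>S. fst p < fst q)"

definition right_of :: "point \<Rightarrow> point set \<Rightarrow> bool" where
  "right_of p S \<longleftrightarrow> (\<forall>q\<in>S. fst q < fst p)"

text \<open>Here the list \<open>ps\<close> starts with the origin, so \<open>ps ! i\<close> is the $i$-th pin.\<close>

fun encodes :: "point list \<Rightarrow> nat \<Rightarrow> letter \<Rightarrow> bool" where
  "encodes ps i U \<longleftrightarrow> separating_pin ps i \<and> above (ps ! i) (bounding_box (set (take i ps)))"
| "encodes ps i D \<longleftrightarrow> separating_pin ps i \<and> below (ps ! i) (bounding_box (set (take i ps)))"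
| "encodes ps i L \<longleftrightarrow> separating_pin ps i \<and> left_of (ps ! i) (bounding_box (set (take i ps)))"
| "encodes ps i R \<longleftrightarrow> separating_pin ps i \<and> right_of (ps ! i) (bounding_box (set (take i ps)))"
| "encodes ps i N1 \<longleftrightarrow> independent_pin ps i \<and>
     above (ps ! i) (bounding_box (set (take i ps))) \<and>
     right_of (ps ! i) (bounding_box (set (take i ps)))"
| "encodes ps i N2 \<longleftrightarrow> independent_pin ps i \<and>
     above (ps ! i) (bounding_box (set (take i ps))) \<and>
     left_of (ps ! i) (bounding_box (set (take i ps)))"
| "encodes ps i N3 \<longleftrightarrow> independent_pin ps i \<and>
     below (ps ! i) (bounding_box (set (take i ps))) \<and>
     left_of (ps ! i) (bounding_box (set (take i ps)))"
| "encodes ps i N4 \<longleftrightarrow> independent_pin ps i \<and>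
     below (ps ! i) (bounding_box (set (take i ps))) \<and>
     right_of (ps ! i) (bounding_box (set (take i ps)))"

definition pin_words :: "nat list \<Rightarrow> letter list set" where
  "pin_words \<pi> =
     {u. \<exists>p0 ps. pin_representation \<pi> ps \<and> pin_sequence (p0 # ps) \<and> length u = length ps \<and>
                 (\<forall>i<length u. encodes (p0 # ps) (Suc i) (u ! i))}"

text \<open>The strong numeral-led factor decomposition: the word is cut before each numeral.\<close>

function factors :: "letter list \<Rightarrow> letter list list" where
  "factors [] = []"
| "factors (a # w) =
     (a # takeWhile (\<lambda>b. b \<notin> numerals) w) # factors (dropWhile (\<lambda>b. b \<notin> numerals) w)"
  by pat_completeness auto
termination
  by (relation "measure length") (auto simp: less_Suc_eq_le length_dropWhile_le)

text \<open>Outside of pairs consisting of a numeral and a direction, the value is irrelevant.\<close>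

fun varphi :: "letter \<Rightarrow> letter \<Rightarrow> letter list" where
  "varphi N1 R = [R, U, R]"
| "varphi N1 L = [R, U, L]"
| "varphi N1 U = [U, R, U]"
| "varphi N1 D = [U, R, D]"
| "varphi N2 R = [L, U, R]"
| "varphi N2 L = [L, U, L]"
| "varphi N2 U = [U, L, U]"
| "varphi N2 D = [U, L, D]"
| "varphi N3 R = [L, D, R]"
| "varphi N3 L = [L, D, L]"
| "varphi N3 U = [D, L, U]"
| "varphi N3 D = [D, L, D]"
| "varphi N4 R = [R, D, R]"
| "varphi N4 L = [R, D, L]"
| "varphi N4 U = [D, R, U]"
| "varphi N4 D = [D, R, D]"
| "varphi _ _ = []"

text \<open>On strict pin words of length at least $2$ the value is a singleton; on words that are
  not strict pin words it is irrelevant.\<close>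

fun phi :: "letter list \<Rightarrow> letter list set" where
  "phi [N1] = {[U, R], [R, U]}"
| "phi [N2] = {[U, L], [L, U]}"
| "phi [N3] = {[D, L], [L, D]}"
| "phi [N4] = {[R, D], [D, R]}"
| "phi (a # b # w) = {varphi a b @ w}"
| "phi _ = {}"

fun lang_factors :: "letter list list \<Rightarrow> letter list set" where
  "lang_factors [] = lists directions"
| "lang_factors (v # vs) =
     {x @ y @ z | x y z. x \<in> lists directions \<and> y \<in> phi v \<and> z \<in> lang_factors vs}"

definition lang_word :: "letter list \<Rightarrow> letter list set" where
  "lang_word u = lang_factors (factors u)"

definition lang_perm :: "nat list \<Rightarrow> letter list set" where
  "lang_perm \<pi> = (\<Union>u\<in>pin_words \<pi>. lang_word u)"

definition alternating_words :: "letter list set" where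
  "alternating_words =
     {w \<in> lists directions. 2 \<le> length w \<and>
        successively (\<lambda>a b. a \<in> {L, R} \<and> b \<in> {U, D} \<or> a \<in> {U, D} \<and> b \<in> {L, R}) w}"

end

theory Submission
  imports Defs
begin

text \<open>
  An alternating word $w = w_0 \dots w_n$ describes a spiral of points $p_0, \dots, p_n$: the point
  $p_i$ is extremal in direction $w_i$ and, for $i \ge 2$, cuts $p_{i-1}$ off from its predecessors;
  $p_1$ lies in the quadrant of $p_0$ given by $w_0$ and $w_1$.
  Take $p_0$ as origin and select some of the other points. Relative to the origin and the selected
  points before it, $p_i$ is read as the direction $w_i$ if $p_{i-1}$ is selected as well, and as
  the numeral of the quadrant spanned by $w_{i-1}$ and $w_i$ otherwise. The map $\phi$ is designed
  so that the words $v$ with $w \in \mathcal{L}(v)$ are exactly those read off from selections. Since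
  a pin word determines its permutation, $w \in \mathcal{L}_\sigma$ iff $\sigma$ is a pattern of
  $p_1, \dots, p_n$.

  Every alternating word has a spiral, and $p_1, \dots, p_n$ is then a proper pin sequence.
  Conversely, a proper pin sequence of length at least $3$ is itself a spiral, so its first point
  can serve as the origin; no additional origin has to be constructed, and the pattern lost with
  that point is harmless because only avoidance is transferred to the word. Both directions thus
  transfer bounds on lengths.
\<close>

section \<open>Pins in terms of coordinates\<close>

text \<open>Signed coordinates turn extremality in each of the four directions into the same
  inequality. The value on numerals is a mere default.\<close>

fun coord :: "letter \<Rightarrow> point \<Rightarrow> real" where
  "coord U p = snd p"
| "coord D p = - snd p"
| "coord L p = - fst p"
| "coord R p = fst p"
| "coord _ p = 0"

definition perp :: "letter \<Rightarrow> letter \<Rightarrow> bool" where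
  "perp a b \<longleftrightarrow> a \<in> {L, R} \<and> b \<in> {U, D} \<or> a \<in> {U, D} \<and> b \<in> {L, R}"

fun vdir :: "letter \<Rightarrow> letter" where
  "vdir N1 = U" | "vdir N2 = U" | "vdir N3 = D" | "vdir N4 = D" | "vdir a = a"

fun hdir :: "letter \<Rightarrow> letter" where
  "hdir N1 = R" | "hdir N2 = L" | "hdir N3 = L" | "hdir N4 = R" | "hdir a = a"

lemma directions_iff: "a \<in> directions \<longleftrightarrow> a \<notin> numerals"
  by (cases a) (auto simp: directions_def numerals_def)

lemma perp_sym: "perp a b \<longleftrightarrow> perp b a"
  by (auto simp: perp_def)

lemma perp_directions: "perp a b \<Longrightarrow> a \<in> directions \<and> b \<in> directions"
  by (auto simp: perp_def directions_def)

text \<open>Opposite directions appear as negated coordinate functions, so that inequalities along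
  \<open>d\<close> can refute inequalities along \<open>e\<close>; perpendicularity is later shown
  by excluding the two parallel cases.\<close>

lemma directions_perp_cases:
  assumes "d \<in> directions" and "e \<in> directions"
  shows "perp d e \<or> e = d \<or> coord e = (\<lambda>p. - coord d p) \<and> e \<noteq> d"
  using assms by (auto simp: directions_def perp_def fun_eq_iff)

lemma perp_perp:
  assumes "perp a d" and "perp a e"
  shows "e = d \<or> coord e = (\<lambda>p. - coord d p)"
  using assms by (auto simp: perp_def fun_eq_iff)

lemma bounding_box_outside_iff:
  assumes "finite S" and "S \<noteq> {}"
  shows "p \<notin> bounding_box S \<longleftrightarrow> (\<exists>d\<in>directions. \<forall>q\<in>S. coord d q < coord d p)"
  using assms
  by (cases p) (auto simp: bounding_box_def directions_def not_le)

text \<open>The box contains \<open>S\<close>, and each of its sides passes through a point of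
  \<open>S\<close>; lying beyond the box is therefore the same as lying beyond
  \<open>S\<close>.\<close>

lemma bounding_box_side_iff:
  assumes "finite S" and "S \<noteq> {}"
  shows "above p (bounding_box S) \<longleftrightarrow> (\<forall>q\<in>S. coord U q < coord U p)"
    and "below p (bounding_box S) \<longleftrightarrow> (\<forall>q\<in>S. coord D q < coord D p)"
    and "left_of p (bounding_box S) \<longleftrightarrow> (\<forall>q\<in>S. coord L q < coord L p)"
    and "right_of p (bounding_box S) \<longleftrightarrow> (\<forall>q\<in>S. coord R q < coord R p)"
proof -
  have mm: "Min (fst ` S) \<le> Max (fst ` S)" "Min (snd ` S) \<le> Max (snd ` S)"
    using assms by (meson Max_ge Min_in finite_imageI image_is_empty)+
  have all: "q \<in> bounding_box S" if "q \<in> S" for q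
    using that assms by (cases q) (auto simp: bounding_box_def intro!: Min_le Max_ge imageI rev_image_eqI)
  define a b c d where "a = Min (fst ` S)" and "b = Max (fst ` S)" and "c = Min (snd ` S)"
    and "d = Max (snd ` S)"
  have corner: "(a, c) \<in> bounding_box S" "(b, d) \<in> bounding_box S"
    using mm by (auto simp: bounding_box_def a_def b_def c_def d_def)
  have box: "a \<le> fst q \<and> fst q \<le> b \<and> c \<le> snd q \<and> snd q \<le> d" if "q \<in> bounding_box S" for q
    using that by (auto simp: bounding_box_def a_def b_def c_def d_def)
  have ex: "\<exists>q\<in>S. fst q = a" "\<exists>q\<in>S. fst q = b" "\<exists>q\<in>S. snd q = c" "\<exists>q\<in>S. snd q = d"
    unfolding a_def b_def c_def d_def using assms
    by (metis (mono_tags, lifting) Max_in Min_in finite_imageI image_iff image_is_empty)+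
  show "above p (bounding_box S) \<longleftrightarrow> (\<forall>q\<in>S. coord U q < coord U p)"
    using all box ex unfolding above_def by (metis coord.simps(1) le_less_trans)
  show "below p (bounding_box S) \<longleftrightarrow> (\<forall>q\<in>S. coord D q < coord D p)"
    using all box ex unfolding below_def by (metis coord.simps(2) less_le_trans neg_less_iff_less)
  show "left_of p (bounding_box S) \<longleftrightarrow> (\<forall>q\<in>S. coord L q < coord L p)"
    using all box ex unfolding left_of_def by (metis coord.simps(3) less_le_trans neg_less_iff_less)
  show "right_of p (bounding_box S) \<longleftrightarrow> (\<forall>q\<in>S. coord R q < coord R p)"
    using all box ex unfolding right_of_def by (metis coord.simps(4) le_less_trans)
qed

lemma separates_iff:
  "separates p {q} F \<longleftrightarrow> F \<noteq> {} \<and>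
     (\<exists>d\<in>directions. coord d p < coord d q \<and> (\<forall>f\<in>F. coord d f < coord d p))"
  by (auto simp: separates_def directions_def)

lemma set_take_nth: "i \<le> length ps \<Longrightarrow> set (take i ps) = (!) ps ` {..<i}"
  by (simp add: nth_image[symmetric] lessThan_atLeast0)

text \<open>The bound \<open>2 \<le> i\<close> expresses that the points from which the last one is
  cut off form a nonempty set.\<close>

lemma separating_pin_iff:
  assumes "i < length ps"
  shows "separating_pin ps i \<longleftrightarrow> 2 \<le> i \<and>
     (\<exists>d\<in>directions. coord d (ps ! i) < coord d (ps ! (i - 1)) \<and>
        (\<forall>j<i - 1. coord d (ps ! j) < coord d (ps ! i)))"
  using assms unfolding separating_pin_def separates_iff
  by (subst set_take_nth)+ (auto simp: lessThan_empty_iff)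

text \<open>All earlier points lie on one side of the vertical line through the pin and on one side
  of the horizontal line, so neither line separates any of them.\<close>

lemma independent_pinI:
  assumes "i < length ps" and "perp d e"
    and "\<And>j. j < i \<Longrightarrow> coord d (ps ! j) < coord d (ps ! i)"
    and "\<And>j. j < i \<Longrightarrow> coord e (ps ! j) < coord e (ps ! i)"
  shows "independent_pin ps i"
proof -
  have *: "coord d q < coord d (ps ! i) \<and> coord e q < coord e (ps ! i)" if "q \<in> set (take i ps)" for q
    using that assms by (auto simp: set_take_nth)
  show ?thesis
    unfolding independent_pin_def
  proof (intro notI, elim exE conjE)
    fix E F assume EF: "E \<subseteq> set (take i ps)" "F \<subseteq> set (take i ps)" "E \<noteq> {}" "F \<noteq> {}"
      and sep: "separates (ps ! i) E F"
    obtain x y where xy: "x \<in> E" "y \<in> F" using EF by auto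
    with sep have "fst x < fst (ps ! i) \<and> fst (ps ! i) < fst y \<or>
      fst y < fst (ps ! i) \<and> fst (ps ! i) < fst x \<or>
      snd x < snd (ps ! i) \<and> snd (ps ! i) < snd y \<or>
      snd y < snd (ps ! i) \<and> snd (ps ! i) < snd x"
      unfolding separates_def by blast
    moreover have "x \<in> set (take i ps)" "y \<in> set (take i ps)" using xy EF by auto
    note *[OF this(1)] *[OF this(2)]
    ultimately show False using \<open>perp d e\<close> by (auto simp: perp_def)
  qed
qed

text \<open>The sequence \<open>p\<close> includes the origin as \<open>p 0\<close>.\<close>

definition pin_at :: "(nat \<Rightarrow> point) \<Rightarrow> nat \<Rightarrow> letter \<Rightarrow> bool" where
  "pin_at p i a \<longleftrightarrow>
     (if a \<in> directions then
        2 \<le> i \<and> (\<forall>j<i. coord a (p j) < coord a (p i)) \<and>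
        (\<exists>e. perp a e \<and> (\<forall>j<i - 1. coord e (p j) < coord e (p i)) \<and> coord e (p i) < coord e (p (i - 1)))
      else \<forall>j<i. coord (vdir a) (p j) < coord (vdir a) (p i) \<and> coord (hdir a) (p j) < coord (hdir a) (p i))"

lemma encodes_iff_pin_at:
  assumes "1 \<le> i" and "i < length ps"
  shows "encodes ps i a \<longleftrightarrow> pin_at ((!) ps) i a"
proof -
  have S: "finite (set (take i ps))" "set (take i ps) \<noteq> {}"
    using assms by auto
  have all: "(\<forall>q\<in>set (take i ps). P q) \<longleftrightarrow> (\<forall>j<i. P (ps ! j))" for P
    using assms by (auto simp: set_take_nth)
  note side = bounding_box_side_iff[OF S, unfolded all]
  have dir: "encodes ps i a \<longleftrightarrow> separating_pin ps i \<and> (\<forall>j<i. coord a (ps ! j) < coord a (ps ! i))"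
    if "a \<in> directions"
    using that by (cases a) (simp_all add: side[of "ps ! i"] directions_def)
  have num: "encodes ps i a \<longleftrightarrow> independent_pin ps i \<and>
    (\<forall>j<i. coord (vdir a) (ps ! j) < coord (vdir a) (ps ! i)) \<and>
    (\<forall>j<i. coord (hdir a) (ps ! j) < coord (hdir a) (ps ! i))" if "a \<in> numerals"
    using that by (cases a) (auto simp add: side[of "ps ! i"] numerals_def)
  show ?thesis
  proof (cases "a \<in> directions")
    case True
    have "(\<exists>e. perp a e \<and> (\<forall>j<i - 1. coord e (ps ! j) < coord e (ps ! i)) \<and> coord e (ps ! i) < coord e (ps ! (i - 1)))
      \<longleftrightarrow> (\<exists>e\<in>directions. coord e (ps ! i) < coord e (ps ! (i - 1)) \<and>
        (\<forall>j<i - 1. coord e (ps ! j) < coord e (ps ! i)))" (is "?l \<longleftrightarrow> ?r")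
      if 2: "2 \<le> i" and a: "\<forall>j<i. coord a (ps ! j) < coord a (ps ! i)"
    proof
      assume ?l then show ?r using perp_directions by blast
    next
      assume ?r
      then obtain e where e: "e \<in> directions" "coord e (ps ! i) < coord e (ps ! (i - 1))"
        "\<forall>j<i - 1. coord e (ps ! j) < coord e (ps ! i)" by blast
      \<comment> \<open>The cut direction is perpendicular to \<open>a\<close>: the point
        \<open>i - 1\<close> lies beyond the pin along \<open>e\<close>, which excludes
        \<open>e = a\<close>, and the point \<open>0\<close> lies behind it, which excludes the
        opposite of \<open>a\<close>.\<close>
      have "coord a (ps ! 0) < coord a (ps ! i)" "coord a (ps ! (i-1)) < coord a (ps ! i)"
        "coord e (ps ! 0) < coord e (ps ! i)"
        using a e(3) 2 by auto
      then have "perp a e"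
        using directions_perp_cases[OF True e(1)] e(2) by force
      then show ?l using e by blast
    qed
    then show ?thesis
      unfolding dir[OF True] separating_pin_iff[OF assms(2)] pin_at_def using True by auto
  next
    case False
    then have "perp (vdir a) (hdir a)" "a \<in> numerals"
      by (auto simp: directions_iff perp_def numerals_def)
    then show ?thesis
      using independent_pinI[OF assms(2)] num False unfolding pin_at_def by auto
  qed
qed

text \<open>By induction on the later index, since a letter fixes the place of its pin among the
  earlier points. A numeral fixes both axes. A direction fixes its own axis and, on the other axis,
  puts the pin between its predecessor and all points before that.\<close>

lemma pin_at_same_order:
  assumes p: "\<And>i. i < length v \<Longrightarrow> pin_at p (Suc i) (v ! i)"
    and q: "\<And>i. i < length v \<Longrightarrow> pin_at q (Suc i) (v ! i)"
    and d: "d \<in> directions"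
    and ij: "j < i" "i \<le> length v"
  shows "coord d (p j) < coord d (p i) \<and> coord d (q j) < coord d (q i) \<or>
         coord d (p i) < coord d (p j) \<and> coord d (q i) < coord d (q j)"
  using ij d
proof (induction i arbitrary: j d rule: less_induct)
  case (less i)
  define a where "a = v ! (i - 1)"
  have pa: "pin_at p i a" and qa: "pin_at q i a"
    using p[of "i - 1"] q[of "i - 1"] less.prems unfolding a_def by auto
  show ?case
  proof (cases "a \<in> directions")
    case True
    with pa qa obtain e e' where i2: "2 \<le> i"
      and a: "\<forall>j<i. coord a (p j) < coord a (p i)" "\<forall>j<i. coord a (q j) < coord a (q i)"
      and e: "perp a e" "\<forall>j<i - 1. coord e (p j) < coord e (p i)" "coord e (p i) < coord e (p (i - 1))"
      and e': "perp a e'" "\<forall>j<i - 1. coord e' (q j) < coord e' (q i)" "coord e' (q i) < coord e' (q (i - 1))"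
      unfolding pin_at_def by auto
    \<comment> \<open>The letter does not record on which side the predecessor is cut off. That side
      is the order of the points \<open>0\<close> and \<open>i - 1\<close>, on which
      \<open>p\<close> and \<open>q\<close> agree by induction.\<close>
    have "coord e (p 0) < coord e (p (i - 1))" "coord e' (q 0) < coord e' (q (i - 1))"
      using e e' i2 by (metis One_nat_def Suc_1 Suc_le_lessD less_trans zero_less_diff)+
    moreover have "e \<in> directions" using e perp_directions by blast
    ultimately have "e' = e"
      using less.IH[of "i - 1" 0 e] i2 less.prems perp_perp[OF e(1) e'(1)] by force
    have cases: "j < i - 1 \<or> j = i - 1" using less.prems by auto
    consider "perp a d" | "d = a" | "coord d = (\<lambda>p. - coord a p)"
      using directions_perp_cases[OF True less.prems(3)] by blast
    then show ?thesis
    proof cases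
      case 1
      then have "d = e \<or> coord d = (\<lambda>p. - coord e p)" using perp_perp e(1) by blast
      then show ?thesis using cases e e' unfolding \<open>e' = e\<close> by auto
    qed (use a less.prems in auto)
  next
    case False
    then have "d = vdir a \<or> d = hdir a \<or> coord d = (\<lambda>p. - coord (vdir a) p) \<or> coord d = (\<lambda>p. - coord (hdir a) p)"
      using less.prems(3) by (cases a; cases d) (auto simp: directions_def fun_eq_iff)
    then show ?thesis using pa qa False less.prems(1) unfolding pin_at_def by auto
  qed
qed

section \<open>Words read off from a spiral\<close>

text \<open>On perpendicular pairs, in either order, this inverts the splitting of a numeral by
  \<open>vdir\<close> and \<open>hdir\<close>.\<close>

definition quad :: "letter \<Rightarrow> letter \<Rightarrow> letter" where
  "quad a b = (if U \<in> {a, b} then if R \<in> {a, b} then N1 else N2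
               else if L \<in> {a, b} then N3 else N4)"

text \<open>
  The word read off from the selection \<open>I\<close> of points of a spiral with word \<open>w\<close>; \<open>s - 1\<close> is the
  index of the previously selected point, and \<open>s = 0\<close> at the start. As \<open>0 \<notin> set I\<close>, the first
  letter is then a numeral.
\<close>

fun vword :: "letter list \<Rightarrow> nat \<Rightarrow> nat list \<Rightarrow> letter list" where
  "vword w s [] = []"
| "vword w s (i # I) = (if i = s then w ! i else quad (w ! (i - 1)) (w ! i)) # vword w (Suc i) I"

lemma quad_numerals: "quad a b \<in> numerals"
  by (simp add: quad_def numerals_def)

lemma perp_quad:
  assumes "perp a b"
  shows "{vdir (quad a b), hdir (quad a b)} = {a, b}"
  using assms by (auto simp: perp_def quad_def)

lemma length_vword [simp]: "length (vword w s I) = length I"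
  by (induction I arbitrary: s) auto

lemma vword_append:
  "vword w s (I @ J) = vword w s I @ vword w (if I = [] then s else Suc (last I)) J"
  by (induction I arbitrary: s) auto

text \<open>In a run of consecutive indices starting at \<open>a\<close>, each index directly
  continues the one before, so \<open>quad\<close> never occurs.\<close>

lemma vword_upt:
  "a \<le> b \<Longrightarrow> b \<le> length w \<Longrightarrow> vword w a [a..<b] = take (b - a) (drop a w)"
proof (induction "b - a" arbitrary: a)
  case (Suc n)
  then have "[a..<b] = a # [Suc a..<b]" "drop a w = w ! a # drop (Suc a) w" "b - a = Suc (b - Suc a)"
    by (auto simp: upt_rec Cons_nth_drop_Suc)
  then show ?case using Suc by simp
qed simp

lemma vword_nth:
  "j < length I \<Longrightarrow> vword w s I ! j =
    (if (if j = 0 then I ! j = s else I ! j = Suc (I ! (j - 1))) then w ! (I ! j)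
     else quad (w ! (I ! j - 1)) (w ! (I ! j)))"
  by (induction I arbitrary: s j) (auto simp: nth_Cons split: nat.splits)

section \<open>Languages of words and selections of positions\<close>

lemma alternating_iff:
  "w \<in> alternating_words \<longleftrightarrow> w \<in> lists directions \<and> 2 \<le> length w \<and> (\<forall>i. Suc i < length w \<longrightarrow> perp (w ! i) (w ! Suc i))"
  by (auto simp: alternating_words_def successively_conv_nth perp_def)

lemma alternating_perp:
  assumes "w \<in> alternating_words" and "0 < i" and "i < length w"
  shows "perp (w ! (i - 1)) (w ! i)"
proof -
  have "\<forall>i. Suc i < length w \<longrightarrow> perp (w ! i) (w ! Suc i)"
    using assms(1) alternating_iff by simp
  then show ?thesis using assms(2,3) by (cases i) auto
qed

text \<open>Of the two orders in which the sides of a quadrant can be written, \<open>varphi\<close>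
  takes the one whose second letter is perpendicular to the direction that follows. When nothing
  follows, \<open>phi\<close> contains both orders.\<close>

lemma phi_quad:
  assumes "perp a b" and "b # ds = [b] \<or> perp b (hd ds)"
  shows "a # b # ds \<in> phi (quad a b # ds)"
proof (cases ds)
  case Nil
  then show ?thesis using assms by (auto simp: perp_def quad_def)
next
  case (Cons c cs)
  then show ?thesis using assms by (auto simp: perp_def quad_def)
qed

text \<open>Every element of \<open>phi (n # ds)\<close> consists of two letters spanning the
  quadrant \<open>n\<close>, followed by \<open>ds\<close>. Selecting all positions of
  \<open>y\<close> but its first gives \<open>n # ds\<close>: the first selected index exceeds
  \<open>s\<close> and is read as a numeral, the others as directions.\<close>

lemma phi_vword:
  assumes w: "w = x @ y @ z" and y: "y \<in> phi (n # ds)" and n: "n \<in> numerals" and ds: "ds \<in> lists directions"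
    and s: "s \<le> length x"
  shows "2 \<le> length y \<and> n # ds = vword w s [Suc (length x) ..< length x + length y]"
proof -
  define k where "k = length x"
  have "\<exists>a b. y = a # b # ds \<and> n = quad a b"
  proof (cases ds)
    case Nil
    then have "y = [y ! 0, y ! 1] \<and> n = quad (y ! 0) (y ! 1)"
      using y n by (cases n) (auto simp: numerals_def quad_def)
    then show ?thesis using Nil by blast
  next
    case (Cons c cs)
    have "c \<in> directions" using Cons ds by auto
    moreover define a b where "a = varphi n c ! 0" and "b = varphi n c ! 1"
    ultimately have "phi (n # ds) = {varphi n c @ cs}" "varphi n c = [a, b, c]" "n = quad a b"
      using n Cons by (cases n; cases c; simp add: numerals_def directions_def quad_def)+
    then show ?thesis using y Cons by auto
  qed
  then obtain a b where ab: "y = a # b # ds" "n = quad a b" by blast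
  have k: "w ! k = a" "w ! Suc k = b" "drop (Suc (Suc k)) w = ds @ z" "k + 2 + length ds \<le> length w"
    unfolding w ab k_def by (simp_all add: nth_append)
  have "[Suc k ..< k + length y] = Suc k # [k + 2 ..< k + 2 + length ds]"
    unfolding ab by (simp add: upt_rec)
  moreover have "vword w (k + 2) [k + 2 ..< k + 2 + length ds] = ds"
    using k by (subst vword_upt) auto
  ultimately show ?thesis using k ab s by (auto simp: k_def)
qed

text \<open>Each factor contributes all of its positions except the first. This gap at the front of
  every factor is what makes its first selected position read as a numeral.\<close>

lemma lang_factors_vword:
  "drop s w \<in> lang_factors vs \<Longrightarrow> s \<le> length w \<Longrightarrow>
    (\<And>v. v \<in> set vs \<Longrightarrow> \<exists>n ds. v = n # ds \<and> n \<in> numerals \<and> ds \<in> lists directions) \<Longrightarrow>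
    \<exists>I. sorted_wrt (<) I \<and> set I \<subseteq> {s<..<length w} \<and> concat vs = vword w s I"
proof (induction vs arbitrary: s)
  case Nil
  then show ?case by (intro exI[of _ "[]"]) auto
next
  case (Cons v vs)
  obtain x y z where xyz: "drop s w = x @ y @ z" "y \<in> phi v" "z \<in> lang_factors vs"
    using Cons.prems by auto
  obtain n ds where v: "v = n # ds" "n \<in> numerals" "ds \<in> lists directions"
    using Cons.prems(3)[of v] by auto
  have w: "w = (take s w @ x) @ y @ z"
    using xyz(1) by (metis append.assoc append_take_drop_id)
  define k t where "k = s + length x" and "t = k + length y"
  have len: "length (take s w @ x) = k" using Cons.prems by (simp add: k_def)
  have y: "2 \<le> length y" "v = vword w s [Suc k..<t]"
    using phi_vword[OF w xyz(2)[unfolded v(1)] v(2,3), of s] v(1) unfolding len t_def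
    by (auto simp: k_def)
  have t: "t \<le> length w" using arg_cong[OF w, of length] len by (simp add: t_def)
  have "drop t w = z"
    by (subst w) (simp add: t_def len[symmetric])
  then obtain I where I: "sorted_wrt (<) I" "set I \<subseteq> {t<..<length w}" "concat vs = vword w t I"
    using Cons.IH[of t] xyz(3) Cons.prems(3) t by auto
  \<comment> \<open>As \<open>y\<close> has at least two letters, the block is nonempty with last
    index \<open>t - 1\<close>, so reading resumes at \<open>t\<close>.\<close>
  have "concat (v # vs) = vword w s ([Suc k..<t] @ I)"
    using y I(3) by (auto simp: vword_append t_def last_upt)
  moreover have "sorted_wrt (<) ([Suc k..<t] @ I)" "set ([Suc k..<t] @ I) \<subseteq> {s<..<length w}"
    using I(1,2) t y(1) by (auto simp: sorted_wrt_append k_def t_def)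
  ultimately show ?case by blast
qed

lemma concat_factors: "concat (factors v) = v"
  by (induction v rule: factors.induct) auto

lemma factors_numeral_led:
  assumes "v = [] \<or> hd v \<in> numerals" and "f \<in> set (factors v)"
  shows "\<exists>n ds. f = n # ds \<and> n \<in> numerals \<and> ds \<in> lists directions"
  using assms
proof (induction v rule: factors.induct)
  case (2 a w)
  have "takeWhile (\<lambda>b. b \<notin> numerals) w \<in> lists directions"
    by (auto simp: directions_iff dest: set_takeWhileD)
  moreover have "dropWhile (\<lambda>b. b \<notin> numerals) w = [] \<or> hd (dropWhile (\<lambda>b. b \<notin> numerals) w) \<in> numerals"
    using hd_dropWhile[of "\<lambda>b. b \<notin> numerals" w] by auto
  ultimately show ?case using 2 by auto
qed simp

text \<open>Reading from \<open>s\<close> may begin in the middle of a factor. The leading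
  directions complete that factor and are literally a prefix of \<open>drop s w\<close>; only the
  remainder splits into factors of its own. In this form the claim passes through the induction on
  \<open>I\<close>.\<close>

lemma vword_lang_aux:
  assumes alt: "\<And>i. Suc i < length w \<Longrightarrow> perp (w ! i) (w ! Suc i)" and dirs: "w \<in> lists directions"
  shows "sorted_wrt (<) I \<Longrightarrow> set I \<subseteq> {s..<length w} - {0} \<Longrightarrow>
    \<exists>z. drop s w = takeWhile (\<lambda>b. b \<notin> numerals) (vword w s I) @ z \<and>
      z \<in> lang_factors (factors (dropWhile (\<lambda>b. b \<notin> numerals) (vword w s I)))"
proof (induction I arbitrary: s)
  case Nil
  then show ?case using dirs by (auto dest: in_set_dropD)
next
  case (Cons i I)
  define v where "v = vword w (Suc i) I"
  have i: "s \<le> i" "0 < i" "i < length w" using Cons.prems by auto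
  have "set I \<subseteq> {Suc i..<length w} - {0}"
    using Cons.prems by (auto simp: subset_iff Suc_le_eq)
  then obtain z where z: "drop (Suc i) w = takeWhile (\<lambda>b. b \<notin> numerals) v @ z"
    "z \<in> lang_factors (factors (dropWhile (\<lambda>b. b \<notin> numerals) v))"
    using Cons.IH[of "Suc i"] Cons.prems unfolding v_def by auto
  have di: "drop i w = w ! i # drop (Suc i) w" using i Cons_nth_drop_Suc by metis
  show ?case
  proof (cases "i = s")
    case True
    have "w ! i \<notin> numerals" using dirs i directions_iff by auto
    then show ?thesis using True z di by (auto simp: v_def)
  next
    case False
    define ds where "ds = takeWhile (\<lambda>b. b \<notin> numerals) v"
    define q where "q = quad (w ! (i - 1)) (w ! i)"
    have pi: "perp (w ! (i - 1)) (w ! i)" using alt[of "i - 1"] i by auto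
    have "perp (w ! i) (hd ds)" if "ds \<noteq> []"
    proof -
      have "Suc i < length w" using z(1) that unfolding ds_def[symmetric]
        by (metis append_is_Nil_conv drop_all not_less)
      moreover have "hd ds = w ! Suc i"
        using z(1) that calculation unfolding ds_def[symmetric] by (metis hd_append2 hd_drop_conv_nth)
      ultimately show ?thesis using alt by auto
    qed
    then have ph: "w ! (i - 1) # w ! i # ds \<in> phi (q # ds)"
      unfolding q_def using pi by (intro phi_quad) auto
    have "drop (i - 1) w = w ! (i - 1) # drop i w"
      using i Cons_nth_drop_Suc[of "i - 1" w] by simp
    moreover have "drop s w = take (i - 1 - s) (drop s w) @ drop (i - 1) w"
      using i False append_take_drop_id[of "i - 1 - s" "drop s w"] by (simp del: append_take_drop_id)
    \<comment> \<open>The new factor begins one letter before the selected index \<open>i\<close>.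
      Since \<open>i\<close> exceeds \<open>s\<close>, the letter \<open>w ! (i - 1)\<close> is
      still free and supplies the other side of the quadrant.\<close>
    ultimately have dec: "drop s w = take (i - 1 - s) (drop s w) @ (w ! (i - 1) # w ! i # ds) @ z"
      using z(1) di unfolding ds_def by simp
    have "take (i - 1 - s) (drop s w) \<in> lists directions"
      using dirs by (auto dest!: in_set_takeD in_set_dropD)
    then have "drop s w \<in> lang_factors ((q # ds) # factors (dropWhile (\<lambda>b. b \<notin> numerals) v))"
      using ph z(2) dec unfolding lang_factors.simps by blast
    moreover have "vword w s (i # I) = q # v" "q \<in> numerals"
      using False by (auto simp: v_def q_def quad_numerals)
    ultimately show ?thesis by (simp add: ds_def)
  qed
qed

lemma lang_word_iff:
  assumes w: "w \<in> alternating_words" and v: "v = [] \<or> hd v \<in> numerals"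
  shows "w \<in> lang_word v \<longleftrightarrow>
    (\<exists>I. sorted_wrt (<) I \<and> set I \<subseteq> {0<..<length w} \<and> v = vword w 0 I)"
proof
  assume "w \<in> lang_word v"
  then show "\<exists>I. sorted_wrt (<) I \<and> set I \<subseteq> {0<..<length w} \<and> v = vword w 0 I"
    using lang_factors_vword[of 0 w "factors v"] w factors_numeral_led[OF v]
    by (auto simp: lang_word_def concat_factors alternating_iff)
next
  assume "\<exists>I. sorted_wrt (<) I \<and> set I \<subseteq> {0<..<length w} \<and> v = vword w 0 I"
  then obtain I where I: "sorted_wrt (<) I" "set I \<subseteq> {0<..<length w}" "v = vword w 0 I"
    by blast
  have "takeWhile (\<lambda>b. b \<notin> numerals) v = []" "dropWhile (\<lambda>b. b \<notin> numerals) v = v"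
    using v by (cases v; auto)+
  moreover have "set I \<subseteq> {0..<length w} - {0}" using I by auto
  ultimately show "w \<in> lang_word v"
    using vword_lang_aux[of w I 0] w I by (auto simp: lang_word_def alternating_iff)
qed

text \<open>The condition \<open>0 < j\<close> exempts the first two points: the point
  \<open>1\<close> does not retreat behind the point \<open>0\<close> along \<open>w ! 0\<close> but
  passes it, and so lies in a quadrant of it.\<close>

definition spiral :: "(nat \<Rightarrow> point) \<Rightarrow> letter list \<Rightarrow> bool" where
  "spiral p w \<longleftrightarrow> (\<forall>i j. j < i \<and> i < length w \<longrightarrow> coord (w ! i) (p j) < coord (w ! i) (p i) \<and>
     (if 0 < j \<and> i = Suc j then coord (w ! j) (p i) < coord (w ! j) (p j)
      else coord (w ! (i - 1)) (p j) < coord (w ! (i - 1)) (p i)))"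

lemma spiral_less:
  assumes "spiral p w" and "j < i" and "i < length w"
  shows "coord (w ! i) (p j) < coord (w ! i) (p i)"
    and "\<not> (0 < j \<and> i = Suc j) \<Longrightarrow> coord (w ! (i - 1)) (p j) < coord (w ! (i - 1)) (p i)"
    and "0 < j \<Longrightarrow> i = Suc j \<Longrightarrow> coord (w ! (i - 1)) (p i) < coord (w ! (i - 1)) (p j)"
  using assms unfolding spiral_def by (auto split: if_splits)

text \<open>Along \<open>w ! (i - 1)\<close> the point \<open>i\<close> passes every earlier point
  except its predecessor, and for \<open>i = 1\<close> also that one. If the predecessor is
  selected, it is cut off and the letter is a direction; otherwise no selected point and not the
  origin obstructs the quadrant.\<close>

lemma pin_at_spiral:
  assumes w: "w \<in> alternating_words" and sp: "spiral p w"
    and I: "sorted_wrt (<) I" "set I \<subseteq> {0<..<length w}" and j: "j < length I"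
  shows "pin_at (\<lambda>k. p ((0 # I) ! k)) (Suc j) (vword w 0 I ! j)"
proof -
  define i where "i = I ! j"
  have i: "0 < i" "i < length w" using I j by (auto simp: i_def dest: nth_mem)
  have perp: "perp (w ! (i - 1)) (w ! i)"
    using alternating_perp[OF w] i by blast
  have mono: "(0 # I) ! k < (0 # I) ! l" if "k < l" "l < Suc (length I)" for k l
  proof -
    have "sorted_wrt (<) (0 # I)" using I by auto
    from sorted_wrt_nth_less[OF this that(1)] show ?thesis using that(2) by simp
  qed
  have pr: "(0 # I) ! k < i" if "k < Suc j" for k
    using mono[of k "Suc j"] that j by (auto simp: i_def)
  have d: "w ! i \<in> directions" using w i by (auto simp: alternating_iff)
  show ?thesis
  proof (cases "0 < j \<and> i = Suc (I ! (j - 1))")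
    case True
    have prev: "(0 # I) ! j = i - 1" using True by (cases j) auto
    have v: "vword w 0 I ! j = w ! i"
      using True j by (auto simp: vword_nth i_def)
    have i1: "0 < i - 1" using mono[of 0 j] True j prev by auto
    have "coord (w ! i) (p ((0 # I) ! k)) < coord (w ! i) (p i)" if "k < Suc j" for k
      using spiral_less(1)[OF sp pr[OF that] i(2)] .
    moreover have "coord (w ! (i - 1)) (p ((0 # I) ! k)) < coord (w ! (i - 1)) (p i)" if "k < j" for k
    proof -
      have "(0 # I) ! k < i - 1" using mono[of k j] that j prev by auto
      then have "(0 # I) ! k < i" "i \<noteq> Suc ((0 # I) ! k)" by linarith+
      then show ?thesis using spiral_less(2)[OF sp _ i(2)] by blast
    qed
    moreover have "coord (w ! (i - 1)) (p i) < coord (w ! (i - 1)) (p (i - 1))"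
      using spiral_less(3)[OF sp _ i(2), of "i - 1"] i i1 by simp
    ultimately show ?thesis
      using d True perp perp_sym[of "w ! (i - 1)"] prev unfolding v pin_at_def
      by (auto simp: i_def[symmetric] intro!: exI[of _ "w ! (i - 1)"])
  next
    case False
    have v: "vword w 0 I ! j = quad (w ! (i - 1)) (w ! i)"
      using False i j unfolding vword_nth[OF j] i_def by auto
    have "coord (w ! i) (p ((0 # I) ! k)) < coord (w ! i) (p i) \<and>
      coord (w ! (i - 1)) (p ((0 # I) ! k)) < coord (w ! (i - 1)) (p i)" if "k < Suc j" for k
    proof -
      \<comment> \<open>An exceptional pair would put \<open>i - 1\<close> among the selected
        indices. Being the largest possible index below \<open>i\<close>, it would be the one
        selected last, against the case assumption.\<close>
      have "\<not> (0 < (0 # I) ! k \<and> i = Suc ((0 # I) ! k))"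
      proof
        assume a: "0 < (0 # I) ! k \<and> i = Suc ((0 # I) ! k)"
        then have "0 < k" by (cases k) auto
        moreover have "k = j"
        proof (rule ccontr)
          assume "k \<noteq> j"
          then have "(0 # I) ! k < (0 # I) ! j" "(0 # I) ! j < i"
            using mono[of k j] pr[of j] that j by auto
          then show False using a by auto
        qed
        ultimately show False using a False by (cases j) auto
      qed
      then show ?thesis using spiral_less(1,2)[OF sp pr[OF that] i(2)] by blast
    qed
    then show ?thesis
      using perp_quad[OF perp] quad_numerals[of "w ! (i - 1)" "w ! i"]
      unfolding v pin_at_def directions_iff by (auto simp: i_def[symmetric] doubleton_eq_iff)
  qed
qed

section \<open>Order isomorphism and patterns\<close>

lemma order_isomorphic_sym:
  assumes "order_isomorphic X Y"
  shows "order_isomorphic Y X"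
proof -
  obtain f where f: "bij_betw f X Y"
    and o: "\<And>p q. p \<in> X \<Longrightarrow> q \<in> X \<Longrightarrow> (fst p < fst q \<longleftrightarrow> fst (f p) < fst (f q)) \<and> (snd p < snd q \<longleftrightarrow> snd (f p) < snd (f q))"
    using assms unfolding order_isomorphic_def by blast
  let ?g = "the_inv_into X f"
  have "bij_betw ?g Y X" using f by (rule bij_betw_the_inv_into)
  moreover have "?g y \<in> X" "f (?g y) = y" if "y \<in> Y" for y
    using that calculation f by (auto simp: bij_betwE f_the_inv_into_f_bij_betw)
  ultimately show ?thesis unfolding order_isomorphic_def using o by metis
qed

lemma order_isomorphic_trans:
  assumes "order_isomorphic X Y" and "order_isomorphic Y Z"
  shows "order_isomorphic X Z"
proof -
  obtain f where f: "bij_betw f X Y"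
    and fo: "\<forall>p\<in>X. \<forall>q\<in>X. (fst p < fst q \<longleftrightarrow> fst (f p) < fst (f q)) \<and> (snd p < snd q \<longleftrightarrow> snd (f p) < snd (f q))"
    using assms unfolding order_isomorphic_def by blast
  obtain g where g: "bij_betw g Y Z"
    and go: "\<forall>p\<in>Y. \<forall>q\<in>Y. (fst p < fst q \<longleftrightarrow> fst (g p) < fst (g q)) \<and> (snd p < snd q \<longleftrightarrow> snd (g p) < snd (g q))"
    using assms unfolding order_isomorphic_def by blast
  have "bij_betw (g \<circ> f) X Z" using f g by (rule bij_betw_trans)
  moreover have "f p \<in> Y" if "p \<in> X" for p using that f bij_betwE by blast
  ultimately show ?thesis unfolding order_isomorphic_def using fo go
    by (intro exI[of _ "g \<circ> f"]) simp
qed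

lemma order_isomorphic_subset:
  assumes "order_isomorphic X Y" and "S \<subseteq> X"
  shows "\<exists>T\<subseteq>Y. order_isomorphic S T"
proof -
  obtain f where f: "bij_betw f X Y"
    and fo: "\<forall>p\<in>X. \<forall>q\<in>X. (fst p < fst q \<longleftrightarrow> fst (f p) < fst (f q)) \<and> (snd p < snd q \<longleftrightarrow> snd (f p) < snd (f q))"
    using assms unfolding order_isomorphic_def by blast
  have "bij_betw f S (f ` S)" using f assms(2) by (auto simp: bij_betw_def intro: inj_on_subset)
  moreover have "f ` S \<subseteq> Y" using f assms(2) by (auto simp: bij_betw_def)
  ultimately show ?thesis using fo assms(2) unfolding order_isomorphic_def by blast
qed

lemma order_isomorphic_images:
  assumes "inj_on f A" and "inj_on g A"
    and "\<And>i j. i \<in> A \<Longrightarrow> j \<in> A \<Longrightarrow> (fst (f i) < fst (f j) \<longleftrightarrow> fst (g i) < fst (g j)) \<and>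
      (snd (f i) < snd (f j) \<longleftrightarrow> snd (g i) < snd (g j))"
  shows "order_isomorphic (f ` A) (g ` A)"
proof -
  let ?h = "g \<circ> the_inv_into A f"
  have "bij_betw ?h (f ` A) (g ` A)"
    using assms(1,2) by (intro bij_betw_trans[OF bij_betw_the_inv_into]) (auto simp: bij_betw_def)
  moreover have "?h (f i) = g i" if "i \<in> A" for i
    using that assms(1) by (simp add: the_inv_into_f_f)
  ultimately show ?thesis unfolding order_isomorphic_def using assms(3)
    by (intro exI[of _ ?h]) auto
qed

lemma diagram_eq: "diagram \<pi> = (\<lambda>i. (real (Suc i), real (\<pi> ! i))) ` {..<length \<pi>}"
  by (auto simp: diagram_def)

text \<open>The first coordinate of a diagram point is its position and the second its value, so
  monotonicity of the embedding and agreement of the values are the two halves of an order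
  isomorphism.\<close>

lemma pattern_of_iff_diagram:
  "pattern_of \<sigma> \<pi> \<longleftrightarrow> (\<exists>S\<subseteq>diagram \<pi>. order_isomorphic S (diagram \<sigma>))"
proof
  assume "pattern_of \<sigma> \<pi>"
  then obtain f where f: "strict_mono_on {..<length \<sigma>} f" "f ` {..<length \<sigma>} \<subseteq> {..<length \<pi>}"
    "\<forall>i<length \<sigma>. \<forall>j<length \<sigma>. \<sigma> ! i < \<sigma> ! j \<longleftrightarrow> \<pi> ! f i < \<pi> ! f j"
    unfolding pattern_of_def by blast
  let ?S = "(\<lambda>i. (real (Suc (f i)), real (\<pi> ! f i))) ` {..<length \<sigma>}"
  have "f i < f j \<longleftrightarrow> i < j" if "i < length \<sigma>" "j < length \<sigma>" for i j
    using strict_mono_on_less[OF f(1)] that by auto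
  then have "order_isomorphic ?S (diagram \<sigma>)"
    unfolding diagram_eq using f(3) strict_mono_on_imp_inj_on[OF f(1)]
    by (intro order_isomorphic_images) (auto simp: inj_on_def)
  moreover have "?S \<subseteq> diagram \<pi>" unfolding diagram_eq using f(2) by auto
  ultimately show "\<exists>S\<subseteq>diagram \<pi>. order_isomorphic S (diagram \<sigma>)" by blast
next
  assume "\<exists>S\<subseteq>diagram \<pi>. order_isomorphic S (diagram \<sigma>)"
  then obtain S where S: "S \<subseteq> diagram \<pi>" "order_isomorphic (diagram \<sigma>) S"
    using order_isomorphic_sym by blast
  then obtain g where g: "bij_betw g (diagram \<sigma>) S"
    and go: "\<forall>p\<in>diagram \<sigma>. \<forall>q\<in>diagram \<sigma>. (fst p < fst q \<longleftrightarrow> fst (g p) < fst (g q)) \<and> (snd p < snd q \<longleftrightarrow> snd (g p) < snd (g q))"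
    unfolding order_isomorphic_def by blast
  let ?p = "\<lambda>i. (real (Suc i), real (\<sigma> ! i))"
  have "\<forall>i\<in>{..<length \<sigma>}. \<exists>k<length \<pi>. g (?p i) = (real (Suc k), real (\<pi> ! k))"
  proof
    fix i assume "i \<in> {..<length \<sigma>}"
    then have "?p i \<in> diagram \<sigma>" by (auto simp: diagram_eq)
    then have "g (?p i) \<in> diagram \<pi>" using g S(1) bij_betwE by blast
    then show "\<exists>k<length \<pi>. g (?p i) = (real (Suc k), real (\<pi> ! k))"
      by (auto simp: diagram_eq)
  qed
  then obtain f where f: "\<forall>i\<in>{..<length \<sigma>}. f i < length \<pi> \<and> g (?p i) = (real (Suc (f i)), real (\<pi> ! f i))"
    using bchoice[of "{..<length \<sigma>}" "\<lambda>i k. k < length \<pi> \<and> g (?p i) = (real (Suc k), real (\<pi> ! k))"] by auto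
  have "(i < j \<longleftrightarrow> f i < f j) \<and> (\<sigma> ! i < \<sigma> ! j \<longleftrightarrow> \<pi> ! f i < \<pi> ! f j)"
    if "i < length \<sigma>" "j < length \<sigma>" for i j
  proof -
    have "?p i \<in> diagram \<sigma>" "?p j \<in> diagram \<sigma>" using that by (auto simp: diagram_eq)
    from go[rule_format, OF this] show ?thesis using f that by auto
  qed
  then show "pattern_of \<sigma> \<pi>"
    unfolding pattern_of_def using f by (intro exI[of _ f]) (auto simp: strict_mono_on_def)
qed

lemma pattern_of_iff_subset:
  assumes "order_isomorphic X (diagram \<pi>)"
  shows "pattern_of \<sigma> \<pi> \<longleftrightarrow> (\<exists>S\<subseteq>X. order_isomorphic S (diagram \<sigma>))"
  unfolding pattern_of_iff_diagram
  using assms order_isomorphic_subset order_isomorphic_sym order_isomorphic_trans by meson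

text \<open>Distinct values make the rank strictly increasing in \<open>f\<close>, hence injective;
  its values lie below \<open>card X\<close>, so counting gives surjectivity.\<close>

lemma bij_betw_rank:
  fixes f :: "'a \<Rightarrow> 'b :: linorder"
  assumes "finite X" and "inj_on f X"
  defines "r \<equiv> \<lambda>x. card {y \<in> X. f y < f x}"
  shows "bij_betw r X {..<card X}"
    and "\<And>x y. x \<in> X \<Longrightarrow> y \<in> X \<Longrightarrow> r x < r y \<longleftrightarrow> f x < f y"
proof -
  have less: "r x < r y" if "x \<in> X" "y \<in> X" "f x < f y" for x y
    unfolding r_def using that assms(1) by (intro psubset_card_mono) auto
  then show iff: "r x < r y \<longleftrightarrow> f x < f y" if "x \<in> X" "y \<in> X" for x y
    using that by (metis assms(2) inj_onD less_asym linorder_neqE)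
  have "inj_on r X"
    using less assms(2) by (metis inj_on_def less_irrefl linorder_neqE)
  moreover have "r ` X \<subseteq> {..<card X}"
    unfolding r_def using assms(1) by (auto intro!: psubset_card_mono)
  ultimately show "bij_betw r X {..<card X}"
    by (simp add: bij_betw_def card_image card_subset_eq)
qed

text \<open>Both coordinates are replaced by their ranks: the permutation lists the vertical ranks
  in the order of the horizontal ones, shifted by one.\<close>

lemma standardization:
  fixes X :: "point set"
  assumes "finite X" and "inj_on fst X" and "inj_on snd X"
  shows "\<exists>\<pi>\<in>perms. order_isomorphic X (diagram \<pi>)"
proof -
  define r s :: "point \<Rightarrow> nat" where "r = (\<lambda>x. card {y \<in> X. fst y < fst x})"
    and "s = (\<lambda>x. card {y \<in> X. snd y < snd x})"
  have r: "bij_betw r X {..<card X}" "\<And>x y. x \<in> X \<Longrightarrow> y \<in> X \<Longrightarrow> r x < r y \<longleftrightarrow> fst x < fst y"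
    using bij_betw_rank[OF assms(1,2)] unfolding r_def by blast+
  have s: "bij_betw s X {..<card X}" "\<And>x y. x \<in> X \<Longrightarrow> y \<in> X \<Longrightarrow> s x < s y \<longleftrightarrow> snd x < snd y"
    using bij_betw_rank[OF assms(1,3)] unfolding s_def by blast+
  let ?h = "the_inv_into X r"
  have h: "bij_betw ?h {..<card X} X" using r(1) by (rule bij_betw_the_inv_into)
  define \<pi> where "\<pi> = map (\<lambda>i. Suc (s (?h i))) [0..<card X]"
  have "bij_betw (Suc \<circ> (s \<circ> ?h)) {..<card X} {1..card X}"
    by (rule bij_betw_trans[OF bij_betw_trans[OF h s(1)]])
      (auto simp: bij_betw_def image_Suc_lessThan)
  then have "set \<pi> = {1..card X}" "distinct \<pi>"
    by (auto simp: \<pi>_def bij_betw_def distinct_map o_def lessThan_atLeast0)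
  then have "\<pi> \<in> perms" unfolding perms_def permutations_of_set_def by blast
  moreover have "order_isomorphic (id ` X) ((\<lambda>x. (real (Suc (r x)), real (Suc (s x)))) ` X)"
    using r s by (intro order_isomorphic_images) (auto simp: inj_on_def bij_betw_def)
  moreover have "diagram \<pi> = (\<lambda>x. (real (Suc (r x)), real (Suc (s x)))) ` X"
  proof -
    have "diagram \<pi> = (\<lambda>i. (real (Suc i), real (Suc (s (?h i))))) ` {..<card X}"
      unfolding diagram_eq by (auto simp: \<pi>_def)
    also have "{..<card X} = r ` X" using r(1) by (simp add: bij_betw_def)
    also have "(\<lambda>i. (real (Suc i), real (Suc (s (?h i))))) ` r ` X = (\<lambda>x. (real (Suc (r x)), real (Suc (s x)))) ` X"
      unfolding image_image using r(1) by (intro image_cong) (auto simp: bij_betw_def the_inv_into_f_f)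
    finally show ?thesis .
  qed
  ultimately show ?thesis by (intro bexI[of _ \<pi>]) (simp_all add: image_id)
qed

section \<open>Pin words and spirals\<close>

text \<open>The conditions on a pin are universal in the earlier points and survive the loss of one
  of them, unless nothing is left to cut off from.\<close>

lemma pin_sequence_tl:
  assumes "pin_sequence (p0 # ps)"
  shows "pin_sequence ps"
proof -
  have "ps ! i \<notin> bounding_box (set (take i ps)) \<and> (separating_pin ps i \<or> independent_pin ps i)"
    if i: "1 \<le> i" "i < length ps" for i
  proof -
    have ps: "ps ! i \<notin> bounding_box (set (take (Suc i) (p0 # ps)))"
      "separating_pin (p0 # ps) (Suc i) \<or> independent_pin (p0 # ps) (Suc i)"
    proof -
      have "\<forall>k. 1 \<le> k \<and> k < length (p0 # ps) \<longrightarrow> (p0 # ps) ! k \<notin> bounding_box (set (take k (p0 # ps))) \<and>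
          (separating_pin (p0 # ps) k \<or> independent_pin (p0 # ps) k)"
        using assms unfolding pin_sequence_def by blast
      from this[rule_format, of "Suc i"] i
      show "ps ! i \<notin> bounding_box (set (take (Suc i) (p0 # ps)))"
        "separating_pin (p0 # ps) (Suc i) \<or> independent_pin (p0 # ps) (Suc i)" by simp_all
    qed
    have ne: "set (take i ps) \<noteq> {}" using i by (cases ps) auto
    have "ps ! i \<notin> bounding_box (set (take i ps))"
      using ps(1) bounding_box_outside_iff[of "set (take i ps)"]
        bounding_box_outside_iff[of "set (take (Suc i) (p0 # ps))"] ne by auto
    moreover have "separating_pin ps i \<or> independent_pin ps i"
      using ps(2)
    proof
      assume sep: "separating_pin (p0 # ps) (Suc i)"
      show ?thesis
      \<comment> \<open>A pin that cut the first pin off from the origin is left with a single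
        predecessor, and one point cannot be separated from itself.\<close>
      proof (cases "i = 1")
        case True
        then have "set (take i ps) = {ps ! 0}" using i by (cases ps) auto
        then have "independent_pin ps i"
          unfolding independent_pin_def separates_def by (auto simp: subset_singleton_iff)
        then show ?thesis ..
      next
        case False
        obtain d where d: "d \<in> directions" "coord d (ps ! i) < coord d (ps ! (i - 1))"
          "\<forall>j<i. coord d ((p0 # ps) ! j) < coord d (ps ! i)"
          using sep i by (subst (asm) separating_pin_iff) auto
        have "coord d (ps ! j) < coord d (ps ! i)" if "j < i - 1" for j
          using d(3)[rule_format, of "Suc j"] that by simp
        then show ?thesis
          using False i d(1,2) by (subst separating_pin_iff) auto
      qed
    next
      assume "independent_pin (p0 # ps) (Suc i)"
      moreover have "set (take i ps) \<subseteq> set (take (Suc i) (p0 # ps))" by auto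
      ultimately have "independent_pin ps i"
        unfolding independent_pin_def nth_Cons_Suc by (meson order_trans)
      then show ?thesis ..
    qed
    ultimately show ?thesis ..
  qed
  then show ?thesis using assms unfolding pin_sequence_def by auto
qed

lemma pin_at_cong:
  assumes "\<And>k. k \<le> i \<Longrightarrow> f k = g k"
  shows "pin_at f i a = pin_at g i a"
  using assms unfolding pin_at_def by auto

text \<open>Comparing \<open>p\<close> with itself, \<open>pin_at_same_order\<close> says that two
  different indices are strictly ordered along each axis.\<close>

lemma pin_at_distinct:
  assumes "\<And>i. i < length v \<Longrightarrow> pin_at p (Suc i) (v ! i)" and "d \<in> directions"
  shows "inj_on (\<lambda>i. coord d (p i)) {..length v}"
  using pin_at_same_order[OF assms(1) assms(1) assms(2)]
  by (intro linorder_inj_onI) force+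

lemma pin_at_pin_sequence:
  assumes "\<And>i. i < length v \<Longrightarrow> pin_at ((!) ps) (Suc i) (v ! i)" and len: "length ps = Suc (length v)"
  shows "pin_sequence ps"
proof -
  have "inj_on (\<lambda>i. fst (ps ! i)) {..<length ps}" "inj_on (\<lambda>i. snd (ps ! i)) {..<length ps}"
    using pin_at_distinct[OF assms(1), of R] pin_at_distinct[OF assms(1), of U]
    by (simp_all add: directions_def len lessThan_Suc_atMost)
  then have "distinct (map fst ps)" "distinct (map snd ps)"
    by (auto simp: distinct_conv_nth inj_on_def)
  moreover have "ps ! i \<notin> bounding_box (set (take i ps)) \<and> (separating_pin ps i \<or> independent_pin ps i)"
    if i: "1 \<le> i" "i < length ps" for i
  proof -
    define a where "a = v ! (i - 1)"
    have pin: "pin_at ((!) ps) i a" using assms(1)[of "i - 1"] i len unfolding a_def by auto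
    then have "encodes ps i a" using encodes_iff_pin_at i by blast
    then have "separating_pin ps i \<or> independent_pin ps i" by (cases a) auto
    moreover have "\<exists>d\<in>directions. \<forall>j<i. coord d (ps ! j) < coord d (ps ! i)"
    proof (cases "a \<in> directions")
      case False
      then have "vdir a \<in> directions" by (cases a) (auto simp: directions_def)
      then show ?thesis using pin False unfolding pin_at_def by auto
    qed (use pin in \<open>auto simp: pin_at_def\<close>)
    then have "ps ! i \<notin> bounding_box (set (take i ps))"
      using i by (subst bounding_box_outside_iff) (auto simp: set_take_nth lessThan_empty_iff)
    ultimately show ?thesis by blast
  qed
  ultimately show ?thesis unfolding pin_sequence_def by blast
qed

text \<open>The letters alone force both sequences, with and without origin, to be pin sequences, so
  only the letters and the order type remain.\<close>

lemma pin_words_iff: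
  "v \<in> pin_words \<sigma> \<longleftrightarrow> (\<exists>p0 ps. length ps = length v \<and> order_isomorphic (set ps) (diagram \<sigma>) \<and>
     (\<forall>i<length v. pin_at ((!) (p0 # ps)) (Suc i) (v ! i)))"
proof -
  have "(pin_representation \<sigma> ps \<and> pin_sequence (p0 # ps) \<and> length v = length ps \<and>
      (\<forall>i<length v. encodes (p0 # ps) (Suc i) (v ! i))) \<longleftrightarrow>
    (length ps = length v \<and> order_isomorphic (set ps) (diagram \<sigma>) \<and>
     (\<forall>i<length v. pin_at ((!) (p0 # ps)) (Suc i) (v ! i)))" for p0 ps
  proof (cases "length ps = length v")
    case True
    have "(\<forall>i<length v. encodes (p0 # ps) (Suc i) (v ! i)) \<longleftrightarrow>
        (\<forall>i<length v. pin_at ((!) (p0 # ps)) (Suc i) (v ! i))" (is "_ \<longleftrightarrow> ?pin")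
      using encodes_iff_pin_at[of "Suc i" "p0 # ps" for i] True by simp
    moreover have "pin_sequence (p0 # ps) \<and> pin_sequence ps" if ?pin
      using pin_at_pin_sequence[of v "p0 # ps"] pin_sequence_tl[of p0 ps] that True by simp
    ultimately show ?thesis using True unfolding pin_representation_def by argo
  qed simp
  then show ?thesis unfolding pin_words_def by simp
qed

text \<open>Only the origin precedes the first pin, so it has nothing to separate.\<close>

lemma pin_words_numeral_led:
  assumes "v \<in> pin_words \<sigma>"
  shows "v = [] \<or> hd v \<in> numerals"
proof (cases v)
  case (Cons a v')
  then obtain p where "pin_at p (Suc 0) a" using assms unfolding pin_words_iff by force
  then have "a \<notin> directions" unfolding pin_at_def by auto
  then show ?thesis using Cons directions_iff by auto
qed simp

text \<open>This is the uniqueness of the permutation of a pin word; the images start at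
  \<open>1\<close> because the origin is no part of it.\<close>

lemma pin_at_order_isomorphic:
  assumes "\<And>i. i < length v \<Longrightarrow> pin_at p (Suc i) (v ! i)"
    and "\<And>i. i < length v \<Longrightarrow> pin_at q (Suc i) (v ! i)"
  shows "order_isomorphic (p ` {1..length v}) (q ` {1..length v})"
proof (rule order_isomorphic_images)
  have inj: "inj_on r {1..length v}" if "\<And>i. i < length v \<Longrightarrow> pin_at r (Suc i) (v ! i)" for r
    using pin_at_distinct[OF that, of U] by (auto simp: directions_def inj_on_def)
  show "inj_on p {1..length v}" "inj_on q {1..length v}" using inj assms by blast+
  fix i j assume ij: "i \<in> {1..length v}" "j \<in> {1..length v}"
  have "coord d (p i) < coord d (p j) \<longleftrightarrow> coord d (q i) < coord d (q j)" if "d \<in> directions" for d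
    using pin_at_same_order[OF assms that, of i j] pin_at_same_order[OF assms that, of j i] ij
    by (cases i j rule: linorder_cases) auto
  from this[of R] this[of U]
  show "(fst (p i) < fst (p j) \<longleftrightarrow> fst (q i) < fst (q j)) \<and> (snd (p i) < snd (p j) \<longleftrightarrow> snd (q i) < snd (q j))"
    by (simp add: directions_def)
qed

lemma set_nth_Cons: "(!) (x # xs) ` {1..length xs} = set xs"
proof -
  have "{1..length xs} = Suc ` {..<length xs}" by (simp add: image_Suc_lessThan)
  then show ?thesis by (auto simp: image_image set_conv_nth)
qed

text \<open>A selection of spiral points and a pin representation of \<open>\<sigma>\<close> that
  carry the same word are order isomorphic. Conversely, the word read off from a copy of
  \<open>\<sigma>\<close> in the spiral is a pin word of \<open>\<sigma>\<close>, with
  \<open>p 0\<close> as origin.\<close>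

lemma spiral_lang_perm_iff:
  assumes w: "w \<in> alternating_words" and sp: "spiral p w"
  shows "w \<in> lang_perm \<sigma> \<longleftrightarrow> (\<exists>S\<subseteq>p ` {0<..<length w}. order_isomorphic S (diagram \<sigma>))"
proof
  assume "w \<in> lang_perm \<sigma>"
  then obtain v where v: "v \<in> pin_words \<sigma>" "w \<in> lang_word v" unfolding lang_perm_def by blast
  then obtain I where I: "sorted_wrt (<) I" "set I \<subseteq> {0<..<length w}" "v = vword w 0 I"
    using lang_word_iff[OF w pin_words_numeral_led[OF v(1)]] by blast
  obtain q0 qs where q: "length qs = length v" "order_isomorphic (set qs) (diagram \<sigma>)"
    "\<forall>i<length v. pin_at ((!) (q0 # qs)) (Suc i) (v ! i)"
    using v(1) unfolding pin_words_iff by blast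
  have "\<forall>i<length v. pin_at (\<lambda>k. p ((0 # I) ! k)) (Suc i) (v ! i)"
    using pin_at_spiral[OF w sp I(1,2)] I(3) by auto
  then have "order_isomorphic ((\<lambda>k. p ((0 # I) ! k)) ` {1..length v}) ((!) (q0 # qs) ` {1..length v})"
    using q by (intro pin_at_order_isomorphic) auto
  also have "(\<lambda>k. p ((0 # I) ! k)) ` {1..length v} = p ` set I"
    unfolding I(3) length_vword set_nth_Cons[of 0 I, symmetric] image_image ..
  finally have "order_isomorphic (p ` set I) (diagram \<sigma>)"
    using order_isomorphic_trans q(1,2) set_nth_Cons by metis
  then show "\<exists>S\<subseteq>p ` {0<..<length w}. order_isomorphic S (diagram \<sigma>)" using I(2) by blast
next
  assume "\<exists>S\<subseteq>p ` {0<..<length w}. order_isomorphic S (diagram \<sigma>)"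
  then obtain J where J: "J \<subseteq> {0<..<length w}" "order_isomorphic (p ` J) (diagram \<sigma>)"
    unfolding subset_image_iff by blast
  define I where "I = sorted_list_of_set J"
  have fin: "finite J" using J(1) finite_subset by blast
  have I: "sorted_wrt (<) I" "set I = J" using fin by (auto simp: I_def)
  define v where "v = vword w 0 I"
  have "pin_at ((!) (map p (0 # I))) (Suc i) (v ! i)" if "i < length I" for i
  proof -
    have "pin_at (\<lambda>k. p ((0 # I) ! k)) (Suc i) (v ! i)"
      using pin_at_spiral[OF w sp I(1)] I(2) J(1) that unfolding v_def by auto
    moreover have "p ((0 # I) ! k) = map p (0 # I) ! k" if "k \<le> Suc i" for k
      using that \<open>i < length I\<close> nth_map[of k "0 # I" p] by simp
    ultimately show ?thesis by (rule iffD1[OF pin_at_cong, rotated])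
  qed
  then have "v \<in> pin_words \<sigma>"
    unfolding pin_words_iff using I J by (intro exI[of _ "p 0"] exI[of _ "map p I"]) (auto simp: v_def)
  moreover have "w \<in> lang_word v"
    using lang_word_iff[OF w pin_words_numeral_led[OF calculation]] I J(1) v_def by blast
  ultimately show "w \<in> lang_perm \<sigma>" unfolding lang_perm_def by blast
qed

section \<open>Existence of spirals\<close>

lemma coord_point_exists:
  assumes "perp a b"
  shows "\<exists>x. coord a x = s \<and> coord b x = t \<and> (\<forall>d\<in>directions. \<bar>coord d x\<bar> \<le> max \<bar>s\<bar> \<bar>t\<bar>)"
proof -
  define \<epsilon> :: "letter \<Rightarrow> real" where "\<epsilon> = (\<lambda>d. if d \<in> {U, R} then 1 else - 1)"
  show ?thesis
    using assms
    by (intro exI[of _ "if a \<in> {L, R} then (\<epsilon> a * s, \<epsilon> b * t) else (\<epsilon> b * t, \<epsilon> a * s)"])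
      (auto simp: perp_def \<epsilon>_def directions_def)
qed

lemma spiral_exists:
  assumes w: "w \<in> alternating_words"
  shows "\<exists>p. spiral p w"
proof -
  \<comment> \<open>The point \<open>i\<close> reaches \<open>2 * i\<close> along
    \<open>w ! i\<close>. Along \<open>w ! (i - 1)\<close> it has \<open>2 * i - 3\<close>, strictly
    between its predecessor at \<open>2 * i - 2\<close> and the bound \<open>2 * i - 4\<close> for
    the points before. For \<open>i = 1\<close> the value \<open>1\<close> replaces
    \<open>-1\<close>, so that the origin is passed.\<close>
  define P where "P = (\<lambda>i x. (\<forall>d\<in>directions. \<bar>coord d x\<bar> \<le> 2 * real i) \<and> (0 < i \<longrightarrow>
    coord (w ! i) x = 2 * real i \<and> coord (w ! (i - 1)) x = (if i = 1 then 1 else 2 * real i - 3)))"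
  have "\<exists>x. P i x" if "i < length w" for i
  proof (cases "i = 0")
    case True
    then have "P i (0, 0)" by (auto simp: P_def directions_def)
    then show ?thesis ..
  next
    case False
    then have "perp (w ! i) (w ! (i - 1))" using alternating_perp[OF w, of i] that perp_sym by blast
    then obtain x where "coord (w ! i) x = 2 * real i"
      "coord (w ! (i - 1)) x = (if i = 1 then 1 else 2 * real i - 3)"
      "\<forall>d\<in>directions. \<bar>coord d x\<bar> \<le> max \<bar>2 * real i\<bar> \<bar>if i = 1 then 1 else 2 * real i - 3\<bar>"
      using coord_point_exists by blast
    moreover have "max \<bar>2 * real i\<bar> \<bar>if i = 1 then 1 else 2 * real i - 3\<bar> \<le> 2 * real i"
      using False by (cases "i = 1") auto
    ultimately have "P i x" unfolding P_def by (meson order_trans)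
    then show ?thesis ..
  qed
  then obtain p where p: "P i (p i)" if "i < length w" for i by metis
  have "spiral p w"
    unfolding spiral_def
  proof (intro allI impI)
    fix i j assume ij: "j < i \<and> i < length w"
    have dir: "w ! i \<in> directions" "w ! (i - 1) \<in> directions"
      using ij w by (auto simp: alternating_iff)
    have Pi: "coord (w ! i) (p i) = 2 * real i"
      "coord (w ! (i - 1)) (p i) = (if i = 1 then 1 else 2 * real i - 3)"
      using p[of i] ij unfolding P_def by auto
    have Pj: "\<And>d. d \<in> directions \<Longrightarrow> \<bar>coord d (p j)\<bar> \<le> 2 * real j"
      "0 < j \<Longrightarrow> coord (w ! j) (p j) = 2 * real j"
      using p[of j] ij unfolding P_def by auto
    have "coord (w ! i) (p j) < coord (w ! i) (p i)"
      using Pj(1)[OF dir(1)] Pi(1) ij by auto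
    moreover have "coord (w ! j) (p i) < coord (w ! j) (p j)" if "0 < j \<and> i = Suc j"
      using Pj(2) Pi(2) that by auto
    moreover have "coord (w ! (i - 1)) (p j) < coord (w ! (i - 1)) (p i)" if "\<not> (0 < j \<and> i = Suc j)"
    proof (cases "j = 0")
      case True
      then show ?thesis using Pj(1)[OF dir(2)] Pi(2) ij by auto
    next
      case False
      then have "real j + 2 \<le> real i" using that ij by auto
      then show ?thesis using Pj(1)[OF dir(2)] Pi(2) False by auto
    qed
    ultimately show "coord (w ! i) (p j) < coord (w ! i) (p i) \<and>
      (if 0 < j \<and> i = Suc j then coord (w ! j) (p i) < coord (w ! j) (p j)
       else coord (w ! (i - 1)) (p j) < coord (w ! (i - 1)) (p i))" by auto
  qed
  then show ?thesis by blast
qed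

section \<open>Proper pin-permutations as spirals\<close>

lemma order_isomorphic_diagram_length:
  assumes "order_isomorphic (set ps) (diagram \<pi>)" and "distinct (map fst ps)"
  shows "length \<pi> = length ps"
proof -
  have "card (set ps) = length ps"
    using assms(2) by (intro distinct_card) (simp add: distinct_map)
  moreover have "card (diagram \<pi>) = length \<pi>"
    unfolding diagram_eq by (subst card_image) (auto simp: inj_on_def)
  ultimately show ?thesis
    using assms(1) bij_betw_same_card unfolding order_isomorphic_def by metis
qed

text \<open>Selecting every point but the origin yields a pin sequence. Removing the origin keeps
  all separations from the third remaining point on, and standardization turns the points into a
  permutation.\<close>

lemma spiral_proper_pin_permutation:
  assumes w: "w \<in> alternating_words" and sp: "spiral p w"
  shows "\<exists>\<pi>. proper_pin_permutation \<pi> \<and> length \<pi> = length w - 1 \<and>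
    order_isomorphic (p ` {0<..<length w}) (diagram \<pi>)"
proof -
  define n where "n = length w - 1"
  define I where "I = [1..<Suc n]"
  define ps where "ps = map p I"
  have lw: "length w = Suc n" using w by (auto simp: n_def alternating_iff)
  have I: "sorted_wrt (<) I" "set I \<subseteq> {0<..<length w}" "length I = n"
    by (auto simp: I_def lw simp del: upt_Suc)
  have nth: "(0 # I) ! k = k" if "k \<le> n" for k
    using that by (cases k) (auto simp: I_def nth_Cons simp del: upt_Suc)
  have pnth: "(p 0 # ps) ! k = p k" if "k \<le> n" for k
    using that nth_map[of k "0 # I" p] nth[OF that] by (simp add: ps_def I(3))
  have psnth: "ps ! k = p (Suc k)" if "k < n" for k
    using pnth[of "Suc k"] that by simp
  have "pin_at ((!) (p 0 # ps)) (Suc i) (vword w 0 I ! i)" if "i < length (vword w 0 I)" for i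
  proof -
    have "pin_at (\<lambda>k. p ((0 # I) ! k)) (Suc i) (vword w 0 I ! i)"
      using pin_at_spiral[OF w sp I(1,2)] that by auto
    moreover have "p ((0 # I) ! k) = (p 0 # ps) ! k" if "k \<le> Suc i" for k
      using that \<open>i < length (vword w 0 I)\<close> pnth nth I(3) by simp
    ultimately show ?thesis by (rule iffD1[OF pin_at_cong, rotated])
  qed
  then have seq: "pin_sequence (p 0 # ps)"
    by (rule pin_at_pin_sequence) (auto simp: ps_def)
  then have seq': "pin_sequence ps" by (rule pin_sequence_tl)
  have set: "set ps = p ` {0<..<length w}" unfolding ps_def I_def lw by (auto simp del: upt_Suc)
  have dist: "distinct (map fst ps)" "distinct (map snd ps)"
    using seq' by (auto simp: pin_sequence_def)
  then obtain \<pi> where \<pi>: "\<pi> \<in> perms" "order_isomorphic (set ps) (diagram \<pi>)"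
    using standardization[of "set ps"] by (auto simp: distinct_map)
  have "separating_pin ps i" if i: "2 \<le> i" "i < length ps" for i
  proof -
    have "i < n" using i by (simp add: ps_def I(3))
    \<comment> \<open>As \<open>ps ! i\<close> is \<open>p (Suc i)\<close>, its predecessor is cut
      off along \<open>w ! i\<close>, the letter before its own.\<close>
    have "w ! i \<in> directions" using w \<open>i < n\<close> lw by (auto simp: alternating_iff)
    moreover have "coord (w ! i) (ps ! i) < coord (w ! i) (ps ! (i - 1))"
      using spiral_less(3)[OF sp, of i "Suc i"] \<open>i < n\<close> i lw by (simp add: psnth)
    moreover have "coord (w ! i) (ps ! j) < coord (w ! i) (ps ! i)" if "j < i - 1" for j
      using spiral_less(2)[OF sp, of "Suc j" "Suc i"] \<open>i < n\<close> i lw that by (simp add: psnth)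
    ultimately show ?thesis using i by (subst separating_pin_iff) auto
  qed
  then have "proper_pin_permutation \<pi>"
    using \<pi> seq' unfolding proper_pin_permutation_def pin_representation_def by blast
  moreover have "length \<pi> = n"
    using order_isomorphic_diagram_length[OF \<pi>(2) dist(1)] by (simp add: ps_def I(3))
  ultimately show ?thesis using \<pi>(2) set n_def by metis
qed

text \<open>Each pin \<open>i\<close> from index \<open>2\<close> on is extremal in a direction
  \<open>d i\<close> and cuts off its predecessor along a perpendicular \<open>e i\<close>. The word
  consists of the directions \<open>d i\<close>, preceded by two letters chosen to fit
  \<open>e 2\<close> and the first two points.\<close>

lemma proper_pin_sequence_spiral:
  assumes seq: "pin_sequence ps" and n: "3 \<le> length ps"
    and sep: "\<And>i. 2 \<le> i \<Longrightarrow> i < length ps \<Longrightarrow> separating_pin ps i"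
  shows "\<exists>w\<in>alternating_words. length w = length ps \<and> spiral ((!) ps) w"
proof -
  let ?p = "(!) ps" and ?n = "length ps"
  define Q where "Q = (\<lambda>i d e. perp d e \<and> (\<forall>j<i. coord d (?p j) < coord d (?p i)) \<and>
    coord e (?p i) < coord e (?p (i - 1)) \<and> (\<forall>j<i - 1. coord e (?p j) < coord e (?p i)))"
  have "\<exists>d e. Q i d e" if i: "2 \<le> i" "i < ?n" for i
  proof -
    obtain e where e: "e \<in> directions" "coord e (?p i) < coord e (?p (i - 1))"
      "\<forall>j<i - 1. coord e (?p j) < coord e (?p i)"
      using sep[OF i] separating_pin_iff i by blast
    have "?p i \<notin> bounding_box (set (take i ps))"
      using seq i unfolding pin_sequence_def by auto
    moreover have "finite (set (take i ps))" "set (take i ps) \<noteq> {}" using i by auto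
    ultimately obtain d where d: "d \<in> directions" "\<forall>q\<in>set (take i ps). coord d q < coord d (?p i)"
      by (subst (asm) bounding_box_outside_iff) auto
    then have d': "\<forall>j<i. coord d (?p j) < coord d (?p i)" using i by (auto simp: set_take_nth)
    have "coord d (?p 0) < coord d (?p i)" "coord d (?p (i - 1)) < coord d (?p i)"
      "coord e (?p 0) < coord e (?p i)" using d' e(3) i by auto
    then have "perp d e" using directions_perp_cases[OF d(1) e(1)] e(2) by force
    then show ?thesis unfolding Q_def using d' e by blast
  qed
  then obtain d e where Q: "Q i (d i) (e i)" if "2 \<le> i" "i < ?n" for i by metis
  have de: "\<And>i. 2 \<le> i \<Longrightarrow> i < ?n \<Longrightarrow> perp (d i) (e i)"
    "\<And>i j. 2 \<le> i \<Longrightarrow> i < ?n \<Longrightarrow> j < i \<Longrightarrow> coord (d i) (?p j) < coord (d i) (?p i)"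
    "\<And>i. 2 \<le> i \<Longrightarrow> i < ?n \<Longrightarrow> coord (e i) (?p i) < coord (e i) (?p (i - 1))"
    "\<And>i j. 2 \<le> i \<Longrightarrow> i < ?n \<Longrightarrow> j < i - 1 \<Longrightarrow> coord (e i) (?p j) < coord (e i) (?p i)"
    using Q unfolding Q_def by blast+
  \<comment> \<open>Along \<open>e (Suc i)\<close> the pin \<open>i\<close> is beyond all earlier
    points, whereas along \<open>e i\<close> it lies between the points \<open>0\<close> and
    \<open>i - 1\<close>. So these directions are perpendicular, and the point \<open>0\<close>
    decides the sign.\<close>
  have ed: "e (Suc i) = d i" if i: "2 \<le> i" "Suc i < ?n" for i
  proof -
    have dirs: "d i \<in> directions" "e i \<in> directions" "e (Suc i) \<in> directions"
      using de(1)[of i] de(1)[of "Suc i"] i perp_directions by auto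
    have 1: "coord (e (Suc i)) (?p j) < coord (e (Suc i)) (?p i)" if "j < i" for j
      using de(3,4)[of "Suc i"] i that by force
    have "coord (e (Suc i)) (?p 0) < coord (e (Suc i)) (?p i)"
      "coord (e (Suc i)) (?p (i - 1)) < coord (e (Suc i)) (?p i)" using 1 i by auto
    moreover have "coord (e i) (?p 0) < coord (e i) (?p i)" "coord (e i) (?p i) < coord (e i) (?p (i - 1))"
      using de(3,4)[of i] i by auto
    ultimately have "perp (e i) (e (Suc i))"
      using directions_perp_cases[OF dirs(2,3)] by force
    then have "e (Suc i) = d i \<or> coord (e (Suc i)) = (\<lambda>p. - coord (d i) p)"
      using perp_perp[of "e i" "d i" "e (Suc i)"] de(1)[of i] i perp_sym by auto
    moreover have "coord (d i) (?p 0) < coord (d i) (?p i)" using de(2) i by auto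
    ultimately show ?thesis using 1[of 0] i by auto
  qed
  have "ps \<noteq> []" using n by auto
  then have neq: "fst (?p 1) \<noteq> fst (?p 0)" "snd (?p 1) \<noteq> snd (?p 0)"
    using seq n nth_eq_iff_index_eq[of "map fst ps" 1 0] nth_eq_iff_index_eq[of "map snd ps" 1 0]
    unfolding pin_sequence_def by auto
  define l where "l = (if e 2 \<in> {U, D} then if fst (?p 0) < fst (?p 1) then R else L
    else if snd (?p 0) < snd (?p 1) then U else D)"
  have "e 2 \<in> directions" using de(1)[of 2] n perp_directions by auto
  then have l: "perp l (e 2)" "coord l (?p 0) < coord l (?p 1)"
    using neq by (auto simp: l_def perp_def directions_def)
  \<comment> \<open>Letter \<open>1\<close> has to be the direction along which the pin
    \<open>2\<close> cuts, and letter \<open>0\<close> the side on which the point \<open>1\<close>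
    passes the point \<open>0\<close> on the other axis.\<close>
  define f where "f = (\<lambda>i. if i = 0 then l else if i = 1 then e 2 else d i)"
  define w where "w = map f [0..<?n]"
  have wn: "length w = ?n" "\<And>i. i < ?n \<Longrightarrow> w ! i = f i" by (auto simp: w_def)
  have fe: "f (i - 1) = e i" if "2 \<le> i" "i < ?n" for i
    using ed[of "i - 1"] that by (cases "i = 2") (auto simp: f_def)
  have fd: "f i = d i" if "2 \<le> i" for i using that by (simp add: f_def)
  have perp: "perp (f i) (f (Suc i))" if "Suc i < ?n" for i
    using fe[of "Suc i"] fd[of "Suc i"] de(1)[of "Suc i"] l(1) that perp_sym
    by (cases "i = 0") (auto simp: f_def)
  have "f i \<in> directions" if "i < ?n" for i
    using perp[of i] perp[of "i - 1"] that n perp_directions by (cases "i = 0") auto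
  then have "w \<in> alternating_words"
    unfolding alternating_iff using perp n by (auto simp: w_def)
  moreover have "spiral ?p w"
    unfolding spiral_def wn(1)
  proof (intro allI impI)
    fix i j assume ij: "j < i \<and> i < ?n"
    show "coord (w ! i) (?p j) < coord (w ! i) (?p i) \<and>
      (if 0 < j \<and> i = Suc j then coord (w ! j) (?p i) < coord (w ! j) (?p j)
       else coord (w ! (i - 1)) (?p j) < coord (w ! (i - 1)) (?p i))"
    proof (cases "2 \<le> i")
      case True
      have "w ! i = d i" "w ! (i - 1) = e i" using fe[OF True] fd[OF True] wn(2) ij by auto
      moreover have "coord (e i) (?p j) < coord (e i) (?p i)" if "\<not> (0 < j \<and> i = Suc j)"
        using de(4)[of i j] True ij that by auto
      ultimately show ?thesis using de(2,3)[of i] True ij by auto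
    next
      case False
      then have "i = 1" "j = 0" using ij by auto
      moreover have "coord (e 2) (?p 0) < coord (e 2) (?p 1)"
        using de(3,4)[of 2] n by force
      moreover have "0 < ?n" "1 < ?n" using n by linarith+
      then have "w ! 0 = l" "w ! 1 = e 2" using wn(2) by (metis f_def zero_neq_one)+
      ultimately show ?thesis using l(2) by simp
    qed
  qed
  ultimately show ?thesis using wn(1) by blast
qed

section \<open>Finiteness as boundedness of length\<close>

lemma finite_bounded_length:
  fixes N :: nat
  shows "finite {\<pi> \<in> perms. length \<pi> \<le> N}" and "finite {w \<in> lists directions. length w \<le> N}"
proof -
  have "{\<pi> \<in> perms. length \<pi> \<le> N} \<subseteq> {xs. set xs \<subseteq> {1..N} \<and> length xs \<le> N}"
    by (auto simp: perms_def permutations_of_set_def dest!: distinct_card)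
  then show "finite {\<pi> \<in> perms. length \<pi> \<le> N}"
    using finite_lists_length_le finite_subset by blast
  have "finite {w. set w \<subseteq> directions \<and> length w \<le> N}"
    by (rule finite_lists_length_le) (simp add: directions_def)
  then show "finite {w \<in> lists directions. length w \<le> N}"
    by (simp add: lists_eq_set)
qed

lemma finite_iff_bounded_lengths:
  assumes "\<And>N. finite {x \<in> A. length x \<le> N}"
  shows "finite A \<longleftrightarrow> (\<exists>N. \<forall>x\<in>A. length x \<le> N)"
proof
  assume "finite A"
  then have "\<forall>x\<in>A. length x \<le> Max (length ` A)" by auto
  then show "\<exists>N. \<forall>x\<in>A. length x \<le> N" ..
next
  assume "\<exists>N. \<forall>x\<in>A. length x \<le> N"
  then obtain N where "A = {x \<in> A. length x \<le> N}" by auto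
  then show "finite A" using assms[of N] by simp
qed

theorem theorem3p18:
  fixes B :: "nat list set"
  assumes "B \<subseteq> perms" and "pattern_antichain B"
  shows "finite {\<pi> \<in> Av B. proper_pin_permutation \<pi>} \<longleftrightarrow>
         finite (alternating_words - (\<Union>\<pi>\<in>B. lang_perm \<pi>))" (is "finite ?P \<longleftrightarrow> finite ?W")
proof -
  have "{x \<in> ?P. length x \<le> N} \<subseteq> {\<pi> \<in> perms. length \<pi> \<le> N}" for N by (auto simp: Av_def)
  then have P: "finite ?P \<longleftrightarrow> (\<exists>N. \<forall>x\<in>?P. length x \<le> N)"
    by (intro finite_iff_bounded_lengths) (rule finite_subset[OF _ finite_bounded_length(1)])
  have "{x \<in> ?W. length x \<le> N} \<subseteq> {w \<in> lists directions. length w \<le> N}" for N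
    by (auto simp: alternating_words_def)
  then have W: "finite ?W \<longleftrightarrow> (\<exists>N. \<forall>x\<in>?W. length x \<le> N)"
    by (intro finite_iff_bounded_lengths) (rule finite_subset[OF _ finite_bounded_length(2)])
  show ?thesis
    unfolding P W
  proof (intro iffI; elim exE)
    fix N assume N: "\<forall>\<pi>\<in>?P. length \<pi> \<le> N"
    \<comment> \<open>The permutation of a spiral is one shorter than its word, because the origin
      is left out.\<close>
    have "length w \<le> Suc N" if "w \<in> ?W" for w
    proof -
      have w: "w \<in> alternating_words" "\<And>\<sigma>. \<sigma> \<in> B \<Longrightarrow> w \<notin> lang_perm \<sigma>" using that by auto
      obtain p where p: "spiral p w" using spiral_exists[OF w(1)] by blast
      obtain \<pi> where \<pi>: "proper_pin_permutation \<pi>" "length \<pi> = length w - 1"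
        "order_isomorphic (p ` {0<..<length w}) (diagram \<pi>)"
        using spiral_proper_pin_permutation[OF w(1) p] by blast
      have "\<not> pattern_of \<sigma> \<pi>" if "\<sigma> \<in> B" for \<sigma>
        using w(2)[OF that] unfolding pattern_of_iff_subset[OF \<pi>(3)] spiral_lang_perm_iff[OF w(1) p] .
      then have "\<pi> \<in> Av B"
        using \<pi>(1) unfolding Av_def proper_pin_permutation_def by simp
      then have "length \<pi> \<le> N" using N \<pi>(1) by blast
      then show ?thesis using \<pi>(2) by linarith
    qed
    then show "\<exists>N. \<forall>w\<in>?W. length w \<le> N" by blast
  next
    fix N assume N: "\<forall>w\<in>?W. length w \<le> N"
    \<comment> \<open>Fewer than three points need not come from a spiral; the \<open>2\<close>
      absorbs these lengths.\<close>
    have "length \<pi> \<le> max 2 N" if "\<pi> \<in> ?P" for \<pi>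
    proof -
      have "proper_pin_permutation \<pi>" using that by simp
      obtain ps where ps: "pin_sequence ps" "order_isomorphic (set ps) (diagram \<pi>)"
        "\<forall>i. 2 \<le> i \<and> i < length ps \<longrightarrow> separating_pin ps i"
        using \<open>proper_pin_permutation \<pi>\<close>
        unfolding proper_pin_permutation_def pin_representation_def by blast
      have len: "length \<pi> = length ps"
        using order_isomorphic_diagram_length ps(1,2) unfolding pin_sequence_def by blast
      show ?thesis
      proof (cases "3 \<le> length ps")
        case True
        obtain w where w: "w \<in> alternating_words" "length w = length ps" "spiral ((!) ps) w"
          using proper_pin_sequence_spiral[OF ps(1) True] ps(3) by blast
        \<comment> \<open>The point \<open>ps ! 0\<close> serves as origin; every pattern of the
          remaining points is a pattern of \<open>\<pi>\<close>, which suffices for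
          avoidance.\<close>
        have "(!) ps ` {0<..<length w} \<subseteq> set ps" using w(2) by auto
        moreover have "\<not> pattern_of \<sigma> \<pi>" if "\<sigma> \<in> B" for \<sigma>
          using that \<open>\<pi> \<in> ?P\<close> unfolding Av_def by blast
        ultimately have "w \<notin> lang_perm \<sigma>" if "\<sigma> \<in> B" for \<sigma>
          using that unfolding spiral_lang_perm_iff[OF w(1,3)] pattern_of_iff_subset[OF ps(2)]
          by (meson order_trans)
        then have "length w \<le> N" using N w(1) by blast
        then show ?thesis using w(2) len by linarith
      qed (use len in simp)
    qed
    then show "\<exists>N. \<forall>\<pi>\<in>?P. length \<pi> \<le> N" by blast
  qed
qed

end
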